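(* Let $\mathcal Q$ be any set of generalized quantifiers of type $(1)$ (no monotonicity or other condition is assumed), let $\psi$ be a formula of $IF(\mathcal Q)$, let $M$ be a structure and let $X$ be a team on $M$ suitable for $\psi$. If $M,X\models\psi$, then $M,Y\models\psi$ for every $Y\subseteq X$.
   Context: A generalized quantifier of type $(1)$ is a class $Q$ of structures $(M,S)$ with $S$ unary; its local version on the domain of a structure $M$ is $Q^M=\{S\subseteq M : (M,S)\in Q\}\subseteq\wp(M)$. An assignment $s$ on $M$ is a function from a finite set of variables $dom(s)$ to $M$; $s(a/v)$ is the assignment with domain $dom(s)\cup\{v\}$ mapping $v$ to $a$ and agreeing with $s$ elsewhere. A team $X$ on $M$ is a set of assignments with a common domain $dom(X)$. For a set $V$ of variables, $s\sim_V s'$ means $s(x)=s'(x)$ for all $x\in dom(s)\setminus V$; a function $F:X\to\wp(M)$ is $V$-uniform if $s\sim_V s'$ implies $F(s)=F(s')$ for $s,s'\in X$. Write $X[F/v]=\{s(a/v): s\in X, a\in F(s)\}$ and $X[M/v]=\{s(a/v): s\in X, a\in M\}$. Formulas of $IF(\mathcal Q)$: atomic first-order formulas $\alpha$, negated atomic formulas $\neg\alpha$, $\psi\land\chi$, $\psi\lor\chi$, $(\exists v/V)\psi$, $(\forall v/V)\psi$, and $(Qv/V)\psi$ for $Q\in\mathcal Q$, where $v$ is a variable and $V$ a finite set of variables. Free variables: $FV(\alpha)=FV(\neg\alpha)$ is the set of variables in $\alpha$; $FV(\psi\land\chi)=FV(\psi\lor\chi)=FV(\psi)\cup FV(\chi)$;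 $FV((\mathsf Qv/V)\psi)=(FV(\psi)\setminus\{v\})\cup V$ for any quantifier symbol $\mathsf Q$. $X$ is suitable for $\psi$ if $dom(X)\supseteq FV(\psi)$. Team semantics: $M,X\models\alpha$ (resp. $\neg\alpha$) iff every $s\in X$ satisfies $\alpha$ (resp. $\neg\alpha$) in the Tarskian sense; $M,X\models\psi\land\chi$ iff $M,X\models\psi$ and $M,X\models\chi$; $M,X\models\psi\lor\chi$ iff there are $Y,Z$ with $Y\cup Z=X$, $M,Y\models\psi$, $M,Z\models\chi$; $M,X\models(\forall v/V)\psi$ iff $M,X[M/v]\models\psi$; $M,X\models(\exists v/V)\psi$ iff $M,X[F/v]\models\psi$ for some $V$-uniform $F:X\to\wp(M)\setminus\{\emptyset\}$; $M,X\models(Qv/V)\psi$ iff $M,X[F/v]\models\psi$ for some $V$-uniform $F:X\to Q^M$. *)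

theory Defs
  imports "HOL-Library.FSet"
begin

section \<open>Vocabularies and structures\<close>

text \<open>A symbol belongs to the vocabulary iff it is assigned an arity; constants are function
  symbols of arity 0.\<close>

record ('f, 'r) vocabulary =
  fun_arity :: "'f \<rightharpoonup> nat"
  rel_arity :: "'r \<rightharpoonup> nat"

record ('a, 'f, 'r) model =
  univ :: "'a set"
  fun_int :: "'f \<Rightarrow> 'a list \<Rightarrow> 'a"
  rel_int :: "'r \<Rightarrow> 'a list set"

definition tuples :: "'a set \<Rightarrow> nat \<Rightarrow> 'a list set" where
  "tuples A n = {as. length as = n \<and> set as \<subseteq> A}"

definition is_structure :: "('f, 'r) vocabulary \<Rightarrow> ('a, 'f, 'r) model \<Rightarrow> bool" where
  "is_structure \<tau> M \<longleftrightarrow>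
     univ M \<noteq> {} \<and>
     (\<forall>f n. fun_arity \<tau> f = Some n \<longrightarrow> (\<forall>as \<in> tuples (univ M) n. fun_int M f as \<in> univ M)) \<and>
     (\<forall>r n. rel_arity \<tau> r = Some n \<longrightarrow> rel_int M r \<subseteq> tuples (univ M) n)"

section \<open>Generalized quantifiers of type (1)\<close>

text \<open>A structure with a single unary relation is a pair \<open>(A, S)\<close> with \<open>S \<subseteq> A\<close>. Domains of
  structures are subsets of an arbitrary type \<open>'a\<close>. Closure under isomorphism is not required.\<close>

type_synonym 'a gquant = "('a set \<times> 'a set) set"

definition is_gquant :: "'a gquant \<Rightarrow> bool" where
  "is_gquant Q \<longleftrightarrow> (\<forall>(A, S) \<in> Q. A \<noteq> {} \<and> S \<subseteq> A)"

definition local_quant :: "'a gquant \<Rightarrow> ('a, 'f, 'r) model \<Rightarrow> 'a set set" where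
  "local_quant Q M = {S. S \<subseteq> univ M \<and> (univ M, S) \<in> Q}"

section \<open>Syntax\<close>

datatype ('f, 'v) trm = Var 'v | Fun 'f "('f, 'v) trm list"

datatype ('f, 'r, 'v) atom =
    Eq "('f, 'v) trm" "('f, 'v) trm"
  | Rel 'r "('f, 'v) trm list"

text \<open>\<open>Exists v V \<psi>\<close>, \<open>Forall v V \<psi>\<close>, \<open>Qu Q v V \<psi>\<close> are the slashed quantifications
  \<open>(\<exists>v/V)\<psi>\<close>, \<open>(\<forall>v/V)\<psi>\<close>, \<open>(Qv/V)\<psi>\<close>; a generalized quantifier serves as its own symbol.\<close>

datatype ('a, 'f, 'r, 'v) form =
    Atom "('f, 'r, 'v) atom"
  | NegAtom "('f, 'r, 'v) atom"
  | And "('a, 'f, 'r, 'v) form" "('a, 'f, 'r, 'v) form"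
  | Or "('a, 'f, 'r, 'v) form" "('a, 'f, 'r, 'v) form"
  | Exists 'v "'v fset" "('a, 'f, 'r, 'v) form"
  | Forall 'v "'v fset" "('a, 'f, 'r, 'v) form"
  | Qu "'a gquant" 'v "'v fset" "('a, 'f, 'r, 'v) form"

primrec wf_trm :: "('f, 'r) vocabulary \<Rightarrow> ('f, 'v) trm \<Rightarrow> bool" where
  "wf_trm \<tau> (Var x) \<longleftrightarrow> True"
| "wf_trm \<tau> (Fun f ts) \<longleftrightarrow>
     fun_arity \<tau> f = Some (length ts) \<and> (\<forall>b \<in> set (map (wf_trm \<tau>) ts). b)"

primrec wf_atom :: "('f, 'r) vocabulary \<Rightarrow> ('f, 'r, 'v) atom \<Rightarrow> bool" where
  "wf_atom \<tau> (Eq t u) \<longleftrightarrow> wf_trm \<tau> t \<and> wf_trm \<tau> u"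
| "wf_atom \<tau> (Rel r ts) \<longleftrightarrow> rel_arity \<tau> r = Some (length ts) \<and> (\<forall>t \<in> set ts. wf_trm \<tau> t)"

primrec IF_formula ::
    "('f, 'r) vocabulary \<Rightarrow> 'a gquant set \<Rightarrow> ('a, 'f, 'r, 'v) form \<Rightarrow> bool" where
  "IF_formula \<tau> \<Q> (Atom \<alpha>) \<longleftrightarrow> wf_atom \<tau> \<alpha>"
| "IF_formula \<tau> \<Q> (NegAtom \<alpha>) \<longleftrightarrow> wf_atom \<tau> \<alpha>"
| "IF_formula \<tau> \<Q> (And \<psi> \<chi>) \<longleftrightarrow> IF_formula \<tau> \<Q> \<psi> \<and> IF_formula \<tau> \<Q> \<chi>"
| "IF_formula \<tau> \<Q> (Or \<psi> \<chi>) \<longleftrightarrow> IF_formula \<tau> \<Q> \<psi> \<and> IF_formula \<tau> \<Q> \<chi>"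
| "IF_formula \<tau> \<Q> (Exists v V \<psi>) \<longleftrightarrow> IF_formula \<tau> \<Q> \<psi>"
| "IF_formula \<tau> \<Q> (Forall v V \<psi>) \<longleftrightarrow> IF_formula \<tau> \<Q> \<psi>"
| "IF_formula \<tau> \<Q> (Qu Q v V \<psi>) \<longleftrightarrow> Q \<in> \<Q> \<and> IF_formula \<tau> \<Q> \<psi>"

primrec vars_trm :: "('f, 'v) trm \<Rightarrow> 'v set" where
  "vars_trm (Var x) = {x}"
| "vars_trm (Fun f ts) = \<Union> (set (map vars_trm ts))"

primrec vars_atom :: "('f, 'r, 'v) atom \<Rightarrow> 'v set" where
  "vars_atom (Eq t u) = vars_trm t \<union> vars_trm u"
| "vars_atom (Rel r ts) = \<Union> (set (map vars_trm ts))"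

primrec FV :: "('a, 'f, 'r, 'v) form \<Rightarrow> 'v set" where
  "FV (Atom \<alpha>) = vars_atom \<alpha>"
| "FV (NegAtom \<alpha>) = vars_atom \<alpha>"
| "FV (And \<psi> \<chi>) = FV \<psi> \<union> FV \<chi>"
| "FV (Or \<psi> \<chi>) = FV \<psi> \<union> FV \<chi>"
| "FV (Exists v V \<psi>) = (FV \<psi> - {v}) \<union> fset V"
| "FV (Forall v V \<psi>) = (FV \<psi> - {v}) \<union> fset V"
| "FV (Qu Q v V \<psi>) = (FV \<psi> - {v}) \<union> fset V"

section \<open>Assignments and teams\<close>

type_synonym ('v, 'a) assignment = "'v \<rightharpoonup> 'a"
type_synonym ('v, 'a) team = "('v, 'a) assignment set"

definition is_assignment :: "('a, 'f, 'r) model \<Rightarrow> ('v, 'a) assignment \<Rightarrow> bool" where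
  "is_assignment M s \<longleftrightarrow> finite (dom s) \<and> ran s \<subseteq> univ M"

text \<open>The domain \<open>D\<close> of a team is an explicit parameter, because the empty team does not
  determine it: the empty team is a team with domain \<open>D\<close> for every finite \<open>D\<close>.\<close>

definition is_team :: "('a, 'f, 'r) model \<Rightarrow> 'v set \<Rightarrow> ('v, 'a) team \<Rightarrow> bool" where
  "is_team M D X \<longleftrightarrow> finite D \<and> (\<forall>s \<in> X. is_assignment M s \<and> dom s = D)"

definition suitable :: "'v set \<Rightarrow> ('a, 'f, 'r, 'v) form \<Rightarrow> bool" where
  "suitable D \<psi> \<longleftrightarrow> FV \<psi> \<subseteq> D"

definition agree_off :: "'v set \<Rightarrow> ('v, 'a) assignment \<Rightarrow> ('v, 'a) assignment \<Rightarrow> bool" where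
  "agree_off V s s' \<longleftrightarrow> (\<forall>x \<in> dom s - V. s x = s' x)"

text \<open>Functions with domain \<open>X\<close> are total functions of which only the values on \<open>X\<close> are used.\<close>

definition uniform :: "'v set \<Rightarrow> ('v, 'a) team \<Rightarrow> (('v, 'a) assignment \<Rightarrow> 'a set) \<Rightarrow> bool" where
  "uniform V X F \<longleftrightarrow> (\<forall>s \<in> X. \<forall>s' \<in> X. agree_off V s s' \<longrightarrow> F s = F s')"

definition supplement ::
    "('v, 'a) team \<Rightarrow> (('v, 'a) assignment \<Rightarrow> 'a set) \<Rightarrow> 'v \<Rightarrow> ('v, 'a) team" where
  "supplement X F v = {s(v \<mapsto> a) | s a. s \<in> X \<and> a \<in> F s}"

definition duplicate :: "('v, 'a) team \<Rightarrow> 'a set \<Rightarrow> 'v \<Rightarrow> ('v, 'a) team" where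
  "duplicate X A v = {s(v \<mapsto> a) | s a. s \<in> X \<and> a \<in> A}"

section \<open>Semantics\<close>

primrec eval :: "('a, 'f, 'r) model \<Rightarrow> ('v, 'a) assignment \<Rightarrow> ('f, 'v) trm \<Rightarrow> 'a" where
  "eval M s (Var x) = the (s x)"
| "eval M s (Fun f ts) = fun_int M f (map (eval M s) ts)"

primrec tarski_sat :: "('a, 'f, 'r) model \<Rightarrow> ('v, 'a) assignment \<Rightarrow> ('f, 'r, 'v) atom \<Rightarrow> bool" where
  "tarski_sat M s (Eq t u) \<longleftrightarrow> eval M s t = eval M s u"
| "tarski_sat M s (Rel r ts) \<longleftrightarrow> map (eval M s) ts \<in> rel_int M r"

primrec team_sat :: "('a, 'f, 'r) model \<Rightarrow> ('v, 'a) team \<Rightarrow> ('a, 'f, 'r, 'v) form \<Rightarrow> bool" where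
  "team_sat M X (Atom \<alpha>) \<longleftrightarrow> (\<forall>s \<in> X. tarski_sat M s \<alpha>)"
| "team_sat M X (NegAtom \<alpha>) \<longleftrightarrow> (\<forall>s \<in> X. \<not> tarski_sat M s \<alpha>)"
| "team_sat M X (And \<psi> \<chi>) \<longleftrightarrow> team_sat M X \<psi> \<and> team_sat M X \<chi>"
| "team_sat M X (Or \<psi> \<chi>) \<longleftrightarrow> (\<exists>Y Z. Y \<union> Z = X \<and> team_sat M Y \<psi> \<and> team_sat M Z \<chi>)"
| "team_sat M X (Exists v V \<psi>) \<longleftrightarrow>
     (\<exists>F. (\<forall>s \<in> X. F s \<in> Pow (univ M) - {{}}) \<and> uniform (fset V) X F \<and>
          team_sat M (supplement X F v) \<psi>)"
| "team_sat M X (Forall v V \<psi>) \<longleftrightarrow> team_sat M (duplicate X (univ M) v) \<psi>"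
| "team_sat M X (Qu Q v V \<psi>) \<longleftrightarrow>
     (\<exists>F. (\<forall>s \<in> X. F s \<in> local_quant Q M) \<and> uniform (fset V) X F \<and>
          team_sat M (supplement X F v) \<psi>)"

end

theory Submission imports Defs begin

text \<open>Satisfaction passes to subteams by induction on the formula, because every witness for
  \<open>X\<close> restricts to one for \<open>Y\<close>. A splitting of \<open>X\<close> is
  intersected with \<open>Y\<close>. A choice function \<open>F\<close> is kept unchanged:
  uniformity and membership of its values are conditions on (pairs of) assignments in the team,
  hence survive in \<open>Y\<close>. The sets \<open>F s\<close> neither grow nor shrink, so an
  arbitrary quantifier behaves like the existential one. By \<open>supplement_mono\<close> and
  \<open>duplicate_mono\<close> the extended teams are again nested, so the induction hypothesis
  applies to them.\<close>

lemma uniform_subset: "uniform V X F \<Longrightarrow> Y \<subseteq> X \<Longrightarrow> uniform V Y F"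
  unfolding uniform_def by blast

lemma supplement_mono: "Y \<subseteq> X \<Longrightarrow> supplement Y F v \<subseteq> supplement X F v"
  unfolding supplement_def by blast

lemma duplicate_mono: "Y \<subseteq> X \<Longrightarrow> duplicate Y A v \<subseteq> duplicate X A v"
  unfolding duplicate_def by blast

text \<open>Both teams are generalized in the induction, since a subformula is evaluated on a part
  of the team or on an extension of it.\<close>

lemma team_sat_subset:
  "team_sat M X \<psi> \<Longrightarrow> Y \<subseteq> X \<Longrightarrow> team_sat M Y \<psi>"
proof (induction \<psi> arbitrary: X Y)
  case (Or \<psi> \<chi>)
  then obtain X1 X2 where X: "X1 \<union> X2 = X" "team_sat M X1 \<psi>" "team_sat M X2 \<chi>"
    by auto
  \<comment> \<open>The traces of \<open>X1\<close> and \<open>X2\<close> on \<open>Y\<close> are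
    subteams of each part and together cover \<open>Y\<close>.\<close>
  have "team_sat M (X1 \<inter> Y) \<psi>" "team_sat M (X2 \<inter> Y) \<chi>"
    by (rule Or.IH(1)[OF X(2) Int_lower1], rule Or.IH(2)[OF X(3) Int_lower1])
  moreover have "(X1 \<inter> Y) \<union> (X2 \<inter> Y) = Y"
    using X(1) Or.prems(2) by blast
  ultimately show ?case
    unfolding team_sat.simps by blast
next
  case (Exists v V \<psi>)
  then obtain F where F: "\<forall>s \<in> X. F s \<in> Pow (univ M) - {{}}" "uniform (fset V) X F"
      "team_sat M (supplement X F v) \<psi>"
    by auto
  \<comment> \<open>The witness for \<open>Y\<close> is the same \<open>F\<close>, now read only on
    \<open>Y\<close>.\<close>
  have "team_sat M (supplement Y F v) \<psi>"
    by (rule Exists.IH[OF F(3) supplement_mono[OF Exists.prems(2)]])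
  moreover have "uniform (fset V) Y F"
    by (rule uniform_subset[OF F(2) Exists.prems(2)])
  moreover have "\<forall>s \<in> Y. F s \<in> Pow (univ M) - {{}}"
    using F(1) Exists.prems(2) by (meson subsetD)
  ultimately show ?case
    unfolding team_sat.simps by blast
next
  case (Forall v V \<psi>)
  then have "team_sat M (duplicate X (univ M) v) \<psi>"
    by simp
  then have "team_sat M (duplicate Y (univ M) v) \<psi>"
    by (rule Forall.IH[OF _ duplicate_mono[OF Forall.prems(2)]])
  then show ?case
    by simp
next
  case (Qu Q v V \<psi>)
  then obtain F where F: "\<forall>s \<in> X. F s \<in> local_quant Q M" "uniform (fset V) X F"
      "team_sat M (supplement X F v) \<psi>"
    by auto
  have "team_sat M (supplement Y F v) \<psi>"
    by (rule Qu.IH[OF F(3) supplement_mono[OF Qu.prems(2)]])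
  moreover have "uniform (fset V) Y F"
    by (rule uniform_subset[OF F(2) Qu.prems(2)])
  moreover have "\<forall>s \<in> Y. F s \<in> local_quant Q M"
    using F(1) Qu.prems(2) by (meson subsetD)
  ultimately show ?case
    unfolding team_sat.simps by blast
\<comment> \<open>Literals are conditions on each single assignment; conjunction uses both induction
  hypotheses on the same pair of teams.\<close>
qed (simp_all, blast+)

theorem mainTheorem1:
  fixes \<tau> :: "('f, 'r) vocabulary"
    and \<Q> :: "'a gquant set"
    and \<psi> :: "('a, 'f, 'r, 'v) form"
    and M :: "('a, 'f, 'r) model"
    and D :: "'v set"
    and X :: "('v, 'a) team"
  assumes "\<forall>Q \<in> \<Q>. is_gquant Q"
    and "IF_formula \<tau> \<Q> \<psi>"
    and "is_structure \<tau> M"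
    and "is_team M D X"
    and "suitable D \<psi>"
    and "team_sat M X \<psi>"
  shows "\<forall>Y. Y \<subseteq> X \<longrightarrow> team_sat M Y \<psi>"
  using team_sat_subset[OF assms(6)] by blast

end
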